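(* Let $B_{F,G}(t,u)$ be the $n\times n$ Bézout matrix of $F(s,v;t,u)$ and $G(s,v;t,u)$ regarded as polynomials in $(s,v)$, and let $D_i(B_{F,G})$ be the gcd of its $(n-i)$-minors. Then $D_0(B_{F,G})=0$ and, for $i=1,\ldots,n-1$, up to nonzero constants, $$D_i(B_{F,G})=c(t,u)^{n-i}\,d_n(t,u)^{n-i}d_{n-1}(t,u)^{n-i-1}\cdots d_{i+1}(t,u).$$
   Context: Let $a,b,c\in\mathbb C[s,v]$ be homogeneous of the same degree $n\ge3$, $\gcd(a,b,c)=1$, with $\phi=(a:b:c):\mathbb P^1\to\mathbb P^2$ birational onto its image $\mathcal C$. $F(s,v;t,u)=a(s,v)c(t,u)-a(t,u)c(s,v)$, $G(s,v;t,u)=b(s,v)c(t,u)-b(t,u)c(s,v)$. Let $p,q$ be a $\mu$-basis (homogeneous basis of degrees $\mu\le n-\mu$ of the free syzygy module of $(a,b,c)$), $p_\phi=\sum_ip_i(s,v)\phi_i(t,u)$, $q_\phi=\sum_iq_i(s,v)\phi_i(t,u)$ with $(\phi_1,\phi_2,\phi_3)=(a,b,c)$, and $S_{p_\phi,q_\phi}(t,u)$ their $n\times n$ Sylvester matrix in $(s,v)$. The singular factors are homogeneous $d_1,\ldots,d_n\in\mathbb C[t,u]$ with $d_n^{n-i+1}\cdots d_{i+1}^2d_i$ equal (up to constant) to the gcd of the $(n+1-i)$-minors of $S_{p_\phi,q_\phi}(t,u)$ for each $i$. *)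

theory Defs
  imports "HOL-Computational_Algebra.Polynomial_Factorial" "HOL-Computational_Algebra.Field_as_Ring"
          "Jordan_Normal_Form.Determinant" "Jordan_Normal_Form.DL_Submatrix"
begin

text \<open>Bivariate polynomials C[x,y] are represented as complex poly poly:
  f = sum_j y^j * f_j(x) (outer variable y, inner variable x).
  For forms in (s,v): x = s, y = v; for forms in (t,u): x = t, y = u.\<close>

type_synonym bpoly = "complex poly poly"

definition homog :: "nat \<Rightarrow> bpoly \<Rightarrow> bool" where
  "homog m f \<longleftrightarrow> (\<forall>j k. coeff (coeff f j) k \<noteq> 0 \<longrightarrow> j + k = m)"

definition hcoeff :: "bpoly \<Rightarrow> nat \<Rightarrow> nat \<Rightarrow> complex" where
  "hcoeff f m k = coeff (coeff f (m - k)) k"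

definition const2 :: "complex \<Rightarrow> bpoly" where
  "const2 z = [:[:z:]:]"

definition eval2 :: "bpoly \<Rightarrow> complex \<Rightarrow> complex \<Rightarrow> complex" where
  "eval2 f x y = poly (poly f [:y:]) x"

text \<open>Points of P^1 given by nonzero pairs (x,y); projective equality.\<close>
definition proj_eq :: "complex \<times> complex \<Rightarrow> complex \<times> complex \<Rightarrow> bool" where
  "proj_eq P Q \<longleftrightarrow> fst P * snd Q = snd P * fst Q"

definition same_image :: "bpoly \<Rightarrow> bpoly \<Rightarrow> bpoly \<Rightarrow> complex \<times> complex \<Rightarrow> complex \<times> complex \<Rightarrow> bool" where
  "same_image a b c P Q \<longleftrightarrow>
     (let ap = eval2 a (fst P) (snd P); bp = eval2 b (fst P) (snd P); cp = eval2 c (fst P) (snd P);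
          aq = eval2 a (fst Q) (snd Q); bq = eval2 b (fst Q) (snd Q); cq = eval2 c (fst Q) (snd Q)
      in ap * bq = bp * aq \<and> ap * cq = cp * aq \<and> bp * cq = cp * bq)"

definition birational_param :: "bpoly \<Rightarrow> bpoly \<Rightarrow> bpoly \<Rightarrow> bool" where
  "birational_param a b c \<longleftrightarrow>
     (\<exists>S. finite S \<and> (\<forall>P Q. P \<noteq> (0,0) \<longrightarrow> Q \<noteq> (0,0) \<longrightarrow> same_image a b c P Q \<longrightarrow>
          \<not> proj_eq P Q \<longrightarrow> (\<exists>R\<in>S. R \<noteq> (0,0) \<and> proj_eq P R)))"

definition phi3 :: "bpoly \<Rightarrow> bpoly \<Rightarrow> bpoly \<Rightarrow> nat \<Rightarrow> bpoly" where
  "phi3 a b c i = (if i = 0 then a else if i = 1 then b else c)"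

definition syzygy :: "bpoly \<Rightarrow> bpoly \<Rightarrow> bpoly \<Rightarrow> (nat \<Rightarrow> bpoly) \<Rightarrow> bool" where
  "syzygy a b c h \<longleftrightarrow> (\<Sum>i<3. h i * phi3 a b c i) = 0"

definition mu_basis :: "bpoly \<Rightarrow> bpoly \<Rightarrow> bpoly \<Rightarrow> nat \<Rightarrow> nat \<Rightarrow> (nat \<Rightarrow> bpoly) \<Rightarrow> (nat \<Rightarrow> bpoly) \<Rightarrow> bool" where
  "mu_basis a b c n \<mu> p q \<longleftrightarrow>
     \<mu> \<le> n - \<mu> \<and> (\<forall>i<3. homog \<mu> (p i) \<and> homog (n - \<mu>) (q i)) \<and>
     syzygy a b c p \<and> syzygy a b c q \<and>
     (\<forall>h. syzygy a b c h \<longrightarrow> (\<exists>\<alpha> \<beta>. \<forall>i<3. h i = \<alpha> * p i + \<beta> * q i)) \<and>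
     (\<forall>\<alpha> \<beta>. (\<forall>i<3. \<alpha> * p i + \<beta> * q i = 0) \<longrightarrow> \<alpha> = 0 \<and> \<beta> = 0)"

text \<open>Coefficient (in C[t,u]) of s^k v^(m-k) in p_phi = sum_i p_i(s,v) phi_i(t,u), p of degree m.\<close>
definition phi_coeff :: "bpoly \<Rightarrow> bpoly \<Rightarrow> bpoly \<Rightarrow> (nat \<Rightarrow> bpoly) \<Rightarrow> nat \<Rightarrow> nat \<Rightarrow> bpoly" where
  "phi_coeff a b c p m k = (\<Sum>i<3. const2 (hcoeff (p i) m k) * phi3 a b c i)"

text \<open>Sylvester matrix (size m1+m2) of two forms of degrees m1, m2 in (s,v), given by their
  coefficient functions P k, Q k (coefficient of s^k v^(deg-k)).\<close>
definition sylvester2 :: "nat \<Rightarrow> nat \<Rightarrow> (nat \<Rightarrow> 'a::zero) \<Rightarrow> (nat \<Rightarrow> 'a) \<Rightarrow> 'a mat" where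
  "sylvester2 m1 m2 P Q = mat (m1 + m2) (m1 + m2) (\<lambda>(i,j).
     if i < m2 then (if i \<le> j \<and> j \<le> i + m1 then P (m1 - (j - i)) else 0)
     else (if i - m2 \<le> j \<and> j \<le> i - m2 + m2 then Q (m2 - (j - (i - m2))) else 0))"

text \<open>Bezout matrix (size m) of two forms of degree m given by coefficient functions
  (f k, g k = coefficient of s^k v^(m-k)), defined by
  (f(x)g(y) - f(y)g(x))/(x - y) = sum_(i,j<m) B_ij x^i y^j (in dehomogenized form).\<close>
definition bezout2 :: "nat \<Rightarrow> (nat \<Rightarrow> 'a::comm_ring_1) \<Rightarrow> (nat \<Rightarrow> 'a) \<Rightarrow> 'a mat" where
  "bezout2 m f g = mat m m (\<lambda>(i,j).
     (\<Sum>l\<le>min i j. (if i + j + 1 - l \<le> m then f (i + j + 1 - l) * g l - f l * g (i + j + 1 - l) else 0)))"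

definition minors :: "'a::comm_ring_1 mat \<Rightarrow> nat \<Rightarrow> 'a set" where
  "minors A k = {det (submatrix A I J) | I J. I \<subseteq> {..<dim_row A} \<and> J \<subseteq> {..<dim_col A}
                                           \<and> card I = k \<and> card J = k}"

definition assoc :: "'a::comm_semiring_1 \<Rightarrow> 'a \<Rightarrow> bool" where
  "assoc x y \<longleftrightarrow> x dvd y \<and> y dvd x"

end

theory Submission
  imports Defs "HOL-Computational_Algebra.Fundamental_Theorem_Algebra"
begin

text \<open>Write \<open>\<phi>(s)\<close> for the vector \<open>(a, b, c)\<close> and \<open>X = \<phi>(t, u)\<close>. Expanding gives
  \<open>F(x) G(y) - F(y) G(x) = c(t, u) X \<sqdot> (\<phi>(x) \<times> \<phi>(y))\<close>. By independence and degrees \<open>\<phi>\<close> is a constant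
  multiple of \<open>p \<times> q\<close>, and \<open>(p \<times> q) \<times> w = q (p \<sqdot> w) - p (q \<sqdot> w)\<close>, so that after division by \<open>x - y\<close> the
  Bezout matrix is \<open>c\<close> times a combination of the coefficient rows of \<open>p\<^sub>\<phi>\<close> and \<open>q\<^sub>\<phi>\<close>, that is, of the
  Sylvester matrix. The transition matrix consists of the coefficients of
  \<open>p(x) \<sqdot> \<phi>(y) / (x - y)\<close> and \<open>q(x) \<sqdot> \<phi>(y) / (x - y)\<close>. It is constant, and it is invertible: a
  kernel vector yields a triple \<open>w\<close> of polynomials of degree less than \<open>n\<close> with
  \<open>p \<sqdot> w = q \<sqdot> w = 0\<close>, hence parallel to \<open>\<phi>\<close>, and \<open>w = 0\<close> because \<open>\<phi>\<close> is primitive of degree \<open>n\<close>.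
  The gcds of the minors therefore agree up to the powers of \<open>c\<close>. The Sylvester matrix is singular
  since \<open>p\<^sub>\<phi>\<close> and \<open>q\<^sub>\<phi>\<close> both vanish at \<open>(s, v) = (t, u)\<close>.\<close>

section \<open>Divisibility of minors\<close>

text \<open>Index functions rather than index sets, because expanding a matrix product row by row
  produces repeated and unsorted indices.\<close>

definition index_minor :: "'a::comm_ring_1 mat \<Rightarrow> nat \<Rightarrow> (nat \<Rightarrow> nat) \<Rightarrow> (nat \<Rightarrow> nat) \<Rightarrow> 'a" where
  "index_minor A k r c = det (mat k k (\<lambda>(i, j). A $$ (r i, c j)))"

lemma index_minor_transpose:
  assumes "\<And>i. i < k \<Longrightarrow> r i < dim_row A" "\<And>i. i < k \<Longrightarrow> c i < dim_col A"
  shows "index_minor (transpose_mat A) k c r = index_minor A k r c"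
proof -
  have "mat k k (\<lambda>(i, j). transpose_mat A $$ (c i, r j)) = transpose_mat (mat k k (\<lambda>(i, j). A $$ (r i, c j)))"
    using assms by (intro eq_matI) auto
  then show ?thesis
    unfolding index_minor_def by (simp add: det_transpose[where n = k])
qed

lemma minor_eq_index_minor:
  assumes "I \<subseteq> {..<dim_row A}" "J \<subseteq> {..<dim_col A}" "card I = k" "card J = k"
  shows "det (submatrix A I J) = index_minor A k (pick I) (pick J)"
proof -
  have "{i. i < dim_row A \<and> i \<in> I} = I" "{i. i < dim_col A \<and> i \<in> J} = J"
    using assms by auto
  then show ?thesis
    using assms by (simp add: submatrix_def index_minor_def)
qed

lemma index_minor_not_inj:
  assumes "\<not> inj_on r {..<k}"
  shows "index_minor A k r c = 0"
proof -
  obtain i j where "i < k" "j < k" "i \<noteq> j" "r i = r j"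
    using assms by (auto simp: inj_on_def)
  then show ?thesis
    unfolding index_minor_def by (intro det_identical_rows[of _ k i j]) (auto simp: row_def)
qed

lemma index_minor_permute_rows:
  assumes "p permutes {0..<k}"
  shows "index_minor A k (r \<circ> p) c = signof p * index_minor A k r c"
proof -
  have *: "mat k k (\<lambda>(i, j). A $$ ((r \<circ> p) i, c j)) =
      mat k k (\<lambda>(i, j). mat k k (\<lambda>(i, j). A $$ (r i, c j)) $$ (p i, j))"
    using permutes_in_image[OF assms] by (intro eq_matI) auto
  show ?thesis
    unfolding index_minor_def * by (rule det_permute_rows[OF _ assms]) auto
qed

lemma pick_bij_betw:
  assumes "finite I" "card I = k"
  shows "bij_betw (pick I) {0..<k} I"
proof -
  have "inj_on (pick I) {0..<k}"
    using assms pick_mono_le[of _ I] by (auto simp: inj_on_def) (metis nat_neq_iff)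
  moreover have "pick I ` {0..<k} \<subseteq> I"
    using assms pick_in_set_le[of _ I] by auto
  ultimately show ?thesis
    using assms by (simp add: bij_betw_def card_image card_subset_eq)
qed

text \<open>Both \<open>r\<close> and the increasing enumeration \<open>pick\<close> are bijections
  from \<open>{0..<k}\<close> onto the range of \<open>r\<close>, so they differ by a
  permutation.\<close>

lemma inj_eq_pick_permuted:
  assumes "inj_on r {..<k}"
  obtains p where "p permutes {0..<k}" "\<And>i. i < k \<Longrightarrow> r i = pick (r ` {..<k}) (p i)"
proof -
  let ?I = "r ` {..<k}"
  have pk: "bij_betw (pick ?I) {0..<k} ?I"
    using assms by (intro pick_bij_betw) (auto simp: card_image)
  have r: "bij_betw r {0..<k} ?I"
    using assms by (simp add: bij_betw_def atLeast0LessThan)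
  let ?q = "\<lambda>i. inv_into {0..<k} (pick ?I) (r i)"
  \<comment> \<open>Extended by the identity, since \<open>permutes\<close> demands fixed points
    outside \<open>{0..<k}\<close>.\<close>
  define p where "p i = (if i \<in> {0..<k} then ?q i else i)" for i
  have "bij_betw ?q {0..<k} {0..<k}"
    using bij_betw_trans[OF r bij_betw_inv_into[OF pk]] by (simp add: o_def)
  then have "bij_betw p {0..<k} {0..<k}"
    by (subst bij_betw_cong[of _ _ ?q]) (auto simp: p_def)
  then have "p permutes {0..<k}"
    by (rule bij_imp_permutes) (simp add: p_def)
  moreover have "r i = pick ?I (p i)" if "i < k" for i
    using that pk by (simp add: p_def bij_betw_def f_inv_into_f)
  ultimately show thesis
    using that by blast
qed

lemma index_minor_cong:
  assumes "\<And>i. i < k \<Longrightarrow> r i = r' i" "\<And>i. i < k \<Longrightarrow> c i = c' i"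
  shows "index_minor A k r c = index_minor A k r' c'"
  unfolding index_minor_def using assms by (intro arg_cong[of _ _ det] cong_mat) auto

text \<open>Repeated rows make the minor vanish; otherwise sorting the rows changes only its sign,
  which divisibility ignores.\<close>

lemma dvd_index_minor_rows:
  assumes "\<And>I. I \<subseteq> {..<dim_row A} \<Longrightarrow> card I = k \<Longrightarrow> g dvd index_minor A k (pick I) c"
    and "\<And>i. i < k \<Longrightarrow> r i < dim_row A"
  shows "g dvd index_minor A k r c"
proof (cases "inj_on r {..<k}")
  case True
  then obtain p where p: "p permutes {0..<k}" "\<And>i. i < k \<Longrightarrow> r i = pick (r ` {..<k}) (p i)"
    using inj_eq_pick_permuted by blast
  have "index_minor A k r c = index_minor A k (pick (r ` {..<k}) \<circ> p) c"
    using p(2) by (intro index_minor_cong) auto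
  also have "\<dots> = signof p * index_minor A k (pick (r ` {..<k})) c"
    by (rule index_minor_permute_rows[OF p(1)])
  finally show ?thesis
    using assms True by (simp add: card_image image_subset_iff)
qed (simp add: index_minor_not_inj)

lemma dvd_minors_iff:
  "(\<forall>x\<in>minors A k. g dvd x) \<longleftrightarrow>
    (\<forall>r c. (\<forall>i<k. r i < dim_row A) \<longrightarrow> (\<forall>i<k. c i < dim_col A) \<longrightarrow> g dvd index_minor A k r c)"
  (is "?L \<longleftrightarrow> ?R")
proof
  assume R: ?R
  have "pick I i \<in> I" if "card I = k" "i < k" for I i
    using that by (intro pick_in_set_le) auto
  then show ?L
    using R unfolding minors_def by (auto simp: minor_eq_index_minor subset_iff)
next
  assume L: ?L
  have *: "g dvd index_minor A k (pick I) (pick J)"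
    if "I \<subseteq> {..<dim_row A}" "card I = k" "J \<subseteq> {..<dim_col A}" "card J = k" for I J
  proof -
    have "det (submatrix A I J) \<in> minors A k"
      unfolding minors_def using that by blast
    then show ?thesis
      using L that by (simp add: minor_eq_index_minor)
  qed
  have pick_lt: "pick I i < m" if "I \<subseteq> {..<m}" "card I = k" "i < k" for I m i
    using pick_in_set_le[of i I] that by auto
  show ?R
  proof (intro allI impI)
    fix r c assume r: "\<forall>i<k. r i < dim_row A" and c: "\<forall>i<k. c i < dim_col A"
    show "g dvd index_minor A k r c"
    proof (rule dvd_index_minor_rows)
      fix I assume I: "I \<subseteq> {..<dim_row A}" "card I = k"
      \<comment> \<open>The columns are sorted by the same row argument, applied to the
        transpose.\<close>
      have "g dvd index_minor (transpose_mat A) k c (pick I)"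
      proof (rule dvd_index_minor_rows)
        fix J assume J: "J \<subseteq> {..<dim_row (transpose_mat A)}" "card J = k"
        then show "g dvd index_minor (transpose_mat A) k (pick J) (pick I)"
          using I * pick_lt by (subst index_minor_transpose) auto
      qed (use c in auto)
      then show "g dvd index_minor A k (pick I) c"
        using I c pick_lt by (subst (asm) index_minor_transpose) auto
    qed (use r in auto)
  qed
qed

lemma dvd_minors_transpose:
  assumes "\<forall>x\<in>minors A k. g dvd x"
  shows "\<forall>x\<in>minors (transpose_mat A) k. g dvd x"
  using assms unfolding dvd_minors_iff by (auto simp: index_minor_transpose)

text \<open>Expanding along the rows writes a minor of the product as a linear combination of minors of
  \<open>A\<close>, so the Cauchy-Binet formula is not needed.\<close>
lemma dvd_minors_mult_left:
  fixes A U :: "'a::comm_ring_1 mat"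
  assumes U: "U \<in> carrier_mat m n" and A: "A \<in> carrier_mat n l"
    and dvd: "\<forall>x\<in>minors A k. g dvd x"
  shows "\<forall>x\<in>minors (U * A) k. g dvd x"
  unfolding dvd_minors_iff
proof (intro allI impI)
  fix r c assume r: "\<forall>i<k. r i < dim_row (U * A)" and c: "\<forall>i<k. c i < dim_col (U * A)"
  define a where "a i s = U $$ (r i, s) \<cdot>\<^sub>v vec k (\<lambda>j. A $$ (s, c j))" for i s
  have a: "a \<in> {0..<k} \<rightarrow> {0..<n} \<rightarrow> carrier_vec k"
    by (auto simp: a_def)
  have "mat k k (\<lambda>(i, j). (U * A) $$ (r i, c j)) =
      mat\<^sub>r k k (\<lambda>i. finsum_vec TYPE('a) k (a i) {0..<n})"
  proof (rule eq_matI)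
    fix i j assume ij: "i < dim_row (mat\<^sub>r k k (\<lambda>i. finsum_vec TYPE('a) k (a i) {0..<n}))"
      "j < dim_col (mat\<^sub>r k k (\<lambda>i. finsum_vec TYPE('a) k (a i) {0..<n}))"
    then have "finsum_vec TYPE('a) k (a i) {0..<n} $ j = (\<Sum>s\<in>{0..<n}. a i s $ j)"
      using a by (intro index_finsum_vec) auto
    then show "mat k k (\<lambda>(i, j). (U * A) $$ (r i, c j)) $$ (i, j) =
        mat\<^sub>r k k (\<lambda>i. finsum_vec TYPE('a) k (a i) {0..<n}) $$ (i, j)"
      using ij r c U A by (simp add: scalar_prod_def a_def)
  qed auto
  then have "index_minor (U * A) k r c =
      (\<Sum>f | (\<forall>i\<in>{0..<k}. f i \<in> {0..<n}) \<and> (\<forall>i. i \<notin> {0..<k} \<longrightarrow> f i = i).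
        det (mat\<^sub>r k k (\<lambda>i. a i (f i))))"
    unfolding index_minor_def using det_linear_rows_sum[OF _ a] by simp
  moreover have "g dvd det (mat\<^sub>r k k (\<lambda>i. a i (f i)))" if "\<forall>i\<in>{0..<k}. f i \<in> {0..<n}" for f
  proof -
    have "det (mat\<^sub>r k k (\<lambda>i. a i (f i))) = (\<Prod>i\<in>{0..<k}. U $$ (r i, f i)) *
        det (mat\<^sub>r k k (\<lambda>i. vec k (\<lambda>j. A $$ (f i, c j))))"
      unfolding a_def by (rule det_rows_mul) auto
    also have "mat\<^sub>r k k (\<lambda>i. vec k (\<lambda>j. A $$ (f i, c j))) = mat k k (\<lambda>(i, j). A $$ (f i, c j))"
      by (intro eq_matI) auto
    finally show ?thesis
      using dvd c that A unfolding dvd_minors_iff by (auto simp: index_minor_def)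
  qed
  ultimately show "g dvd index_minor (U * A) k r c"
    by (auto intro: dvd_sum)
qed

lemma dvd_minors_mult_right:
  fixes A U :: "'a::comm_ring_1 mat"
  assumes A: "A \<in> carrier_mat m n" and U: "U \<in> carrier_mat n l"
    and dvd: "\<forall>x\<in>minors A k. g dvd x"
  shows "\<forall>x\<in>minors (A * U) k. g dvd x"
proof -
  have "\<forall>x\<in>minors (transpose_mat U * transpose_mat A) k. g dvd x"
    using A U dvd by (intro dvd_minors_mult_left[of _ l n _ m] dvd_minors_transpose) auto
  then have "\<forall>x\<in>minors (transpose_mat (transpose_mat U * transpose_mat A)) k. g dvd x"
    by (rule dvd_minors_transpose)
  then show ?thesis
    by (simp flip: transpose_mult[OF A U])
qed

section \<open>Gcds of minors under equivalence, transposition and scaling\<close>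

lemma Gcd_eqI_dvd:
  fixes A B :: "'a::semiring_Gcd set"
  assumes "\<And>g. (\<forall>x\<in>A. g dvd x) \<longleftrightarrow> (\<forall>x\<in>B. g dvd x)"
  shows "Gcd A = Gcd B"
proof -
  have "Gcd A dvd Gcd B" "Gcd B dvd Gcd A"
    using assms by (blast intro: Gcd_greatest Gcd_dvd)+
  then show ?thesis
    by (rule associated_eqI) (rule normalize_Gcd)+
qed

text \<open>Undoing \<open>U\<close> and \<open>V\<close> writes \<open>A\<close> as a two-sided
  multiple of \<open>B\<close> as well, so both families of minors have the same common
  divisors.\<close>

lemma Gcd_minors_equivalent:
  fixes A :: "'a::{comm_ring_1,semiring_Gcd} mat"
  assumes A: "A \<in> carrier_mat m n" "B \<in> carrier_mat m n"
    and U: "U \<in> carrier_mat m m" "U' \<in> carrier_mat m m" "U' * U = 1\<^sub>m m"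
    and V: "V \<in> carrier_mat n n" "V' \<in> carrier_mat n n" "V * V' = 1\<^sub>m n"
    and B: "B = U * A * V"
  shows "Gcd (minors B k) = Gcd (minors A k)"
proof -
  have "U' * B * V' = (U' * U) * A * (V * V')"
    using A(1) U(1,2) V(1,2) by (simp add: B assoc_mult_mat[of _ m m _ n _ n] assoc_mult_mat[of _ m m _ m _ n] assoc_mult_mat[of _ m n _ n _ n])
  then have A': "A = U' * B * V'"
    using A U V by simp
  have 1: "\<forall>x\<in>minors B k. g dvd x" if "\<forall>x\<in>minors A k. g dvd x" for g
    unfolding B using A U V that
    by (intro dvd_minors_mult_right[of _ m n] dvd_minors_mult_left[of _ m m]) auto
  have 2: "\<forall>x\<in>minors A k. g dvd x" if "\<forall>x\<in>minors B k. g dvd x" for g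
    by (subst A', intro dvd_minors_mult_right[of _ m n] dvd_minors_mult_left[of _ m m]) (use A U V that in auto)
  show ?thesis
    by (rule Gcd_eqI_dvd) (use 1 2 in blast)
qed

lemma Gcd_minors_transpose:
  fixes A :: "'a::{comm_ring_1,semiring_Gcd} mat"
  shows "Gcd (minors (transpose_mat A) k) = Gcd (minors A k)"
  by (rule Gcd_eqI_dvd) (metis dvd_minors_transpose transpose_transpose)

lemma minors_smult:
  "minors (c \<cdot>\<^sub>m A) k = (*) (c ^ k) ` minors A k"
proof -
  have *: "det (submatrix (c \<cdot>\<^sub>m A) I J) = c ^ k * det (submatrix A I J)"
    if "I \<subseteq> {..<dim_row A}" "J \<subseteq> {..<dim_col A}" "card I = k" "card J = k" for I J
  proof -
    have "pick I i < dim_row A" "pick J i < dim_col A" if "i < k" for i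
      using pick_in_set_le[of i I] pick_in_set_le[of i J] that \<open>card I = k\<close> \<open>card J = k\<close>
        \<open>I \<subseteq> _\<close> \<open>J \<subseteq> _\<close> by auto
    then have "mat k k (\<lambda>(i, j). (c \<cdot>\<^sub>m A) $$ (pick I i, pick J j)) =
        c \<cdot>\<^sub>m mat k k (\<lambda>(i, j). A $$ (pick I i, pick J j))"
      by (intro eq_matI) auto
    then show ?thesis
      using that by (simp add: minor_eq_index_minor index_minor_def)
  qed
  show ?thesis
  proof (intro equalityI subsetI)
    fix x assume "x \<in> minors (c \<cdot>\<^sub>m A) k"
    then show "x \<in> (*) (c ^ k) ` minors A k"
      unfolding minors_def by (force simp: *)
  next
    fix x assume "x \<in> (*) (c ^ k) ` minors A k"
    then obtain I J where IJ: "I \<subseteq> {..<dim_row A}" "J \<subseteq> {..<dim_col A}" "card I = k" "card J = k"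
      and "x = c ^ k * det (submatrix A I J)"
      unfolding minors_def by auto
    then have "x = det (submatrix (c \<cdot>\<^sub>m A) I J)"
      by (simp only: *)
    then show "x \<in> minors (c \<cdot>\<^sub>m A) k"
      unfolding minors_def using IJ by auto
  qed
qed

lemma minors_full:
  assumes "A \<in> carrier_mat n n"
  shows "minors A n = {det A}"
proof -
  have *: "I = {..<n}" if "I \<subseteq> {..<n}" "card I = n" for I :: "nat set"
    using that by (simp add: card_subset_eq)
  \<comment> \<open>On an initial segment the increasing enumeration is the identity.\<close>
  have **: "pick {..<n} i = i" if "i < n" for i
    using pick_card_in_set[of i "{..<n}"] that
    by (metis (no_types, lifting) Collect_cong card_Collect_less_nat lessThan_iff order_less_trans)
  have "submatrix A {..<n} {..<n} = A"
    using assms ** by (intro eq_matI) (auto simp: submatrix_def)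
  moreover have "minors A n = {det (submatrix A {..<n} {..<n})}"
  proof (intro equalityI subsetI)
    fix x assume "x \<in> minors A n"
    then obtain I J where "I \<subseteq> {..<n}" "card I = n" "J \<subseteq> {..<n}" "card J = n" "x = det (submatrix A I J)"
      using assms unfolding minors_def by auto
    then show "x \<in> {det (submatrix A {..<n} {..<n})}"
      using *[of I] *[of J] by simp
  qed (use assms in \<open>auto simp: minors_def intro!: exI[of _ "{..<n}"]\<close>)
  ultimately show ?thesis
    by simp
qed

section \<open>Tails of polynomials and plane \<open>\<mu>\<close>-bases\<close>

definition dot3 :: "(nat \<Rightarrow> 'a::comm_ring_1) \<Rightarrow> (nat \<Rightarrow> 'a) \<Rightarrow> 'a" where
  "dot3 f g = (\<Sum>i<3. f i * g i)"

text \<open>Cyclic indices modulo 3 treat all components uniformly. Triples are functions on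
  \<open>nat\<close> of which only the values at 0, 1, 2 matter.\<close>

definition cross3 :: "(nat \<Rightarrow> 'a::comm_ring_1) \<Rightarrow> (nat \<Rightarrow> 'a) \<Rightarrow> nat \<Rightarrow> 'a" where
  "cross3 f g i = f ((i + 1) mod 3) * g ((i + 2) mod 3) - f ((i + 2) mod 3) * g ((i + 1) mod 3)"

lemma less_3_cases: "i < 3 \<longleftrightarrow> i = 0 \<or> i = 1 \<or> i = (2::nat)"
  by auto

lemma sum_lessThan_3: "(\<Sum>i<3. f i) = f 0 + f 1 + f (2::nat)"
  by (simp add: numeral_3_eq_3 numeral_2_eq_2)

lemma cross3_simps:
  "cross3 f g 0 = f 1 * g 2 - f 2 * g 1"
  "cross3 f g 1 = f 2 * g 0 - f 0 * g 2"
  "cross3 f g 2 = f 0 * g 1 - f 1 * g 0"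
  by (simp_all add: cross3_def flip: numeral_2_eq_2)

lemma cross3_cross3_left:
  "i < 3 \<Longrightarrow> cross3 (cross3 p q) f i = q i * dot3 p f - p i * dot3 q f"
  by (auto simp: less_3_cases cross3_simps[unfolded One_nat_def] cross3_simps dot3_def sum_lessThan_3 algebra_simps)

lemma cross3_eq_0_iff:
  "(\<forall>i<3. cross3 f g i = 0) \<longleftrightarrow> (\<forall>i<3. \<forall>j<3. f i * g j = f j * g i)"
  by (auto simp: less_3_cases cross3_simps[unfolded One_nat_def] cross3_simps all_conj_distrib mult.commute)

text \<open>Weight the relations \<open>f i * g j = f j * g i\<close> by \<open>u j\<close> and sum
  over \<open>j\<close>; no division is required.\<close>

lemma parallel_unimodular:
  assumes u: "dot3 u f = 1" and cross: "\<And>i. i < 3 \<Longrightarrow> cross3 f g i = 0" and i: "i < 3"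
  shows "g i = dot3 u g * f i"
proof -
  have "dot3 u g * f i = (\<Sum>j<3. u j * (f i * g j))"
    unfolding dot3_def sum_distrib_right by (intro sum.cong) (simp_all add: mult_ac)
  also have "\<dots> = (\<Sum>j<3. u j * (f j * g i))"
    using cross i cross3_eq_0_iff[of f g] by (intro sum.cong) auto
  also have "\<dots> = dot3 u f * g i"
    unfolding dot3_def sum_distrib_right by (intro sum.cong) (simp_all add: mult_ac)
  finally show ?thesis
    using u by simp
qed

text \<open>This is the coefficient of \<open>y^j\<close> in \<open>(f(x) - f(y)) / (x - y)\<close>,
  as a polynomial in \<open>x\<close>.\<close>

abbreviation tail :: "nat \<Rightarrow> 'a::comm_ring_1 poly \<Rightarrow> 'a poly" where
  "tail j \<equiv> poly_shift (Suc j)"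

lemma poly_shift_cutoff:
  "monom 1 k * poly_shift k f + poly_cutoff k f = (f :: 'a::comm_ring_1 poly)"
  by (rule poly_eqI) (auto simp: coeff_monom_mult coeff_poly_shift coeff_poly_cutoff)

lemma degree_poly_cutoff_le: "degree (poly_cutoff (Suc j) f) \<le> j"
  by (rule degree_le) (simp add: coeff_poly_cutoff)

text \<open>\<open>x^(j+1)\<close> times the tail of \<open>f\<close> agrees with \<open>f\<close> up to degree \<open>j\<close>, so for a syzygy the
  combination of the tails is minus the combination of the truncations, divided by \<open>x^(j+1)\<close>.\<close>
lemma coeff_dot3_tail_eq_0:
  fixes p f :: "nat \<Rightarrow> 'a::comm_ring_1 poly"
  assumes p: "\<And>i. i < 3 \<Longrightarrow> degree (p i) \<le> m" and syz: "dot3 p f = 0" and k: "m \<le> k"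
  shows "coeff (dot3 p (\<lambda>i. tail j (f i))) k = 0"
proof -
  have "dot3 p f = monom 1 (Suc j) * dot3 p (\<lambda>i. tail j (f i)) + dot3 p (\<lambda>i. poly_cutoff (Suc j) (f i))"
    unfolding dot3_def sum_distrib_left sum.distrib[symmetric]
    by (intro sum.cong refl) (subst (1) poly_shift_cutoff[symmetric, of _ "Suc j"], simp only: algebra_simps)
  then have "monom 1 (Suc j) * dot3 p (\<lambda>i. tail j (f i)) = - dot3 p (\<lambda>i. poly_cutoff (Suc j) (f i))"
    using syz by (simp add: eq_neg_iff_add_eq_0)
  moreover have "coeff (monom 1 (Suc j) * dot3 p (\<lambda>i. tail j (f i))) (k + Suc j) =
      coeff (dot3 p (\<lambda>i. tail j (f i))) k"
    by (simp add: coeff_monom_mult)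
  moreover have "coeff (p i * poly_cutoff (Suc j) (f i)) (k + Suc j) = 0" if "i < 3" for i
  proof (rule coeff_eq_0)
    have "degree (p i * poly_cutoff (Suc j) (f i)) \<le> m + j"
      using degree_mult_le[of "p i" "poly_cutoff (Suc j) (f i)"] p[OF that] degree_poly_cutoff_le[of j "f i"] by linarith
    then show "degree (p i * poly_cutoff (Suc j) (f i)) < k + Suc j"
      using k by simp
  qed
  then have "coeff (dot3 p (\<lambda>i. poly_cutoff (Suc j) (f i))) (k + Suc j) = 0"
    by (simp add: dot3_def coeff_sum)
  ultimately show ?thesis
    by (metis coeff_minus neg_equal_0_iff_equal)
qed

text \<open>Divide \<open>f(x) g(y) - f(y) g(x) = g(x) (f(x) - f(y)) - f(x) (g(x) - g(y))\<close> by
  \<open>x - y\<close> and take the coefficient of \<open>y^j\<close>.\<close>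

lemma bezout2_eq_coeff:
  fixes f g :: "'a::comm_ring_1 poly"
  assumes deg: "degree f \<le> n" "degree g \<le> n" and ij: "i < n" "j < n"
  shows "bezout2 n (coeff f) (coeff g) $$ (i, j) = coeff (g * tail j f - f * tail j g) i"
proof -
  let ?s = "i + j + 1"
  let ?h = "\<lambda>l. coeff f (?s - l) * coeff g l - coeff f l * coeff g (?s - l)"
  have "bezout2 n (coeff f) (coeff g) $$ (i, j) = (\<Sum>l\<le>min i j. ?h l)"
    using ij deg by (auto simp: bezout2_def coeff_eq_0 intro!: sum.cong)
  also have "\<dots> = (\<Sum>l\<le>i. ?h l)"
  proof (cases "i \<le> j")
    case False
    \<comment> \<open>The surplus terms cancel in pairs under the reflection of \<open>l\<close> to
      \<open>i + j + 1 - l\<close>.\<close>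
    have "(\<Sum>l\<in>{j+1..i}. coeff f (?s - l) * coeff g l) = (\<Sum>l\<in>{j+1..i}. coeff f l * coeff g (?s - l))"
      by (rule sum.reindex_bij_witness[of _ "\<lambda>l. ?s - l" "\<lambda>l. ?s - l"]) auto
    then have "(\<Sum>l\<in>{j+1..i}. ?h l) = 0"
      by (simp add: sum_subtractf)
    moreover have "{..i} = {..min i j} \<union> {j+1..i}"
      using False by auto
    ultimately show ?thesis
      by (simp add: sum.union_disjoint)
  qed (simp add: min_def)
  also have "\<dots> = coeff (g * tail j f - f * tail j g) i"
    by (auto simp: coeff_mult coeff_poly_shift sum_subtractf[symmetric] mult.commute algebra_simps Suc_diff_le intro!: sum.cong)
  finally show ?thesis .
qed

text \<open>The data of a \<open>\<mu>\<close>-basis after setting \<open>v = 1\<close>. Coprimality of the three forms becomes the Bezout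
  relation with the coefficients \<open>u\<close> together with \<open>degree_eq\<close>, which excludes the common factor \<open>v\<close>.\<close>
locale plane_mu_basis =
  fixes \<phi> p q u :: "nat \<Rightarrow> 'a::field poly" and n \<mu> :: nat
  assumes mu_le: "\<mu> \<le> n" and n_pos: "0 < n"
    and degree_phi: "i < 3 \<Longrightarrow> degree (\<phi> i) \<le> n"
    and degree_p: "i < 3 \<Longrightarrow> degree (p i) \<le> \<mu>"
    and degree_q: "i < 3 \<Longrightarrow> degree (q i) \<le> n - \<mu>"
    and syz_p: "dot3 p \<phi> = 0" and syz_q: "dot3 q \<phi> = 0"
    and unimodular: "dot3 u \<phi> = 1"
    and independent: "\<exists>i<3. cross3 p q i \<noteq> 0"
    and degree_eq: "\<exists>i<3. degree (\<phi> i) = n"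
begin

text \<open>The triple product identity makes \<open>cross3 p q\<close> parallel to
  \<open>\<phi>\<close>, hence a polynomial multiple \<open>h\<close> of it by unimodularity;
  degrees then force \<open>h\<close> to be constant.\<close>

lemma cross_eq_smult:
  obtains \<kappa> where "\<kappa> \<noteq> 0" "\<And>i. i < 3 \<Longrightarrow> \<phi> i = smult \<kappa> (cross3 p q i)"
proof -
  define h where "h = dot3 u (cross3 p q)"
  have "cross3 \<phi> (cross3 p q) i = - cross3 (cross3 p q) \<phi> i" if "i < 3" for i
    by (simp add: cross3_def)
  then have "cross3 \<phi> (cross3 p q) i = 0" if "i < 3" for i
    using that by (simp add: cross3_cross3_left syz_p syz_q)
  then have h: "cross3 p q i = h * \<phi> i" if "i < 3" for i
    using parallel_unimodular[OF unimodular _ that] by (simp add: h_def)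
  obtain a where a: "a < 3" "degree (\<phi> a) = n"
    using degree_eq by blast
  have h0: "h \<noteq> 0"
    using h independent by auto
  have "degree (p i * q j) \<le> n" if "i < 3" "j < 3" for i j
    using degree_mult_le[of "p i" "q j"] degree_p[OF that(1)] degree_q[OF that(2)] mu_le by linarith
  then have "degree (cross3 p q a) \<le> n"
    unfolding cross3_def by (intro degree_diff_le) auto
  moreover have "\<phi> a \<noteq> 0"
    using a n_pos by auto
  \<comment> \<open>Component \<open>a\<close> of \<open>\<phi>\<close> already has degree
    \<open>n\<close>, the bound for the cross product.\<close>
  ultimately have "degree h = 0"
    using h[OF a(1)] h0 a by (simp add: degree_mult_eq)
  then obtain e where e: "h = [:e:]"
    by (metis degree_eq_zeroE)
  with h0 h have "\<phi> i = smult (1 / e) (cross3 p q i)" if "i < 3" for i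
    using that by simp
  then show thesis
    using that[of "1 / e"] e h0 by simp
qed

text \<open>Fixed once by choice so that \<open>trans_mat\<close> can refer to it.\<close>

definition kappa :: 'a where
  "kappa = (SOME \<kappa>. \<kappa> \<noteq> 0 \<and> (\<forall>i<3. \<phi> i = smult \<kappa> (cross3 p q i)))"

lemma kappa: "kappa \<noteq> 0" "i < 3 \<Longrightarrow> \<phi> i = smult kappa (cross3 p q i)"
proof -
  have "kappa \<noteq> 0 \<and> (\<forall>i<3. \<phi> i = smult kappa (cross3 p q i))"
    unfolding kappa_def by (rule someI_ex) (metis cross_eq_smult)
  then show "kappa \<noteq> 0" "i < 3 \<Longrightarrow> \<phi> i = smult kappa (cross3 p q i)"
    by auto
qed

abbreviation tail_phi :: "nat \<Rightarrow> nat \<Rightarrow> 'a poly" where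
  "tail_phi j \<equiv> \<lambda>i. tail j (\<phi> i)"

lemma cross3_phi:
  assumes "i < 3"
  shows "cross3 \<phi> f i = smult kappa (q i * dot3 p f - p i * dot3 q f)"
proof -
  have "cross3 \<phi> f i = smult kappa (cross3 (cross3 p q) f i)"
    unfolding cross3_def[of \<phi>] cross3_def[of "cross3 p q"]
    by (simp add: kappa(2) smult_diff_right del: mod_Suc_eq)
  then show ?thesis
    using assms by (simp add: cross3_cross3_left)
qed

text \<open>With its analogue for \<open>q\<close>, this ensures that the \<open>n\<close> columns
  of \<open>trans_mat\<close> capture every coefficient of the two dot products.\<close>

lemma coeff_tail_p: "\<mu> \<le> k \<Longrightarrow> coeff (dot3 p (tail_phi j)) k = 0"
  using degree_p syz_p by (rule coeff_dot3_tail_eq_0)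

lemma coeff_tail_q: "n - \<mu> \<le> k \<Longrightarrow> coeff (dot3 q (tail_phi j)) k = 0"
  using degree_q syz_q by (rule coeff_dot3_tail_eq_0)

text \<open>Row \<open>j\<close> lists, in descending powers, the multipliers of \<open>p\<close>
  and then of \<open>q\<close> in \<open>cross3_phi\<close> for the tail \<open>j\<close>, negated.
  The order matches the shifted rows of \<open>sylvester2\<close>: first \<open>n - \<mu>\<close>
  rows from \<open>p\<close>, then \<open>\<mu>\<close> rows from \<open>q\<close>.\<close>

definition trans_mat :: "'a mat" where
  "trans_mat = mat n n (\<lambda>(j, r).
     if r < n - \<mu> then kappa * coeff (dot3 q (tail_phi j)) (n - \<mu> - 1 - r)
     else - kappa * coeff (dot3 p (tail_phi j)) (\<mu> - 1 - (r - (n - \<mu>))))"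

lemma det_trans_mat: "det trans_mat \<noteq> 0"
proof
  assume "det trans_mat = 0"
  then have "det (transpose_mat trans_mat) = 0"
    by (simp add: det_transpose[where n = n] trans_mat_def)
  then obtain v where v: "v \<in> carrier_vec n" "v \<noteq> 0\<^sub>v n" "transpose_mat trans_mat *\<^sub>v v = 0\<^sub>v n"
    using det_0_iff_vec_prod_zero_field[of "transpose_mat trans_mat" n] by (auto simp: trans_mat_def)
  \<comment> \<open>The kernel vector gives weights for the tails; its equations say that all
    coefficients of \<open>dot3 q f\<close> and \<open>dot3 p f\<close> vanish.\<close>
  define f where "f i = (\<Sum>j<n. smult (v $ j) (tail_phi j i))" for i
  have dot_f: "coeff (dot3 g f) k = (\<Sum>j<n. v $ j * coeff (dot3 g (tail_phi j)) k)" for g k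
    unfolding dot3_def f_def by (simp add: sum_distrib_left coeff_sum sum.swap[of _ "{..<3}"])
  have ker: "(\<Sum>j<n. v $ j * trans_mat $$ (j, r)) = 0" if "r < n" for r
  proof -
    have "(transpose_mat trans_mat *\<^sub>v v) $ r = 0"
      using v(3) that by simp
    then show ?thesis
      using v(1) that by (simp add: scalar_prod_def trans_mat_def atLeast0LessThan mult.commute)
  qed
  have "coeff (dot3 q f) k = 0" for k
  proof (cases "k < n - \<mu>")
    case True
    have "kappa * coeff (dot3 q f) k = (\<Sum>j<n. v $ j * trans_mat $$ (j, n - \<mu> - 1 - k))"
      unfolding dot_f sum_distrib_left using True by (intro sum.cong) (auto simp: trans_mat_def)
    also have "\<dots> = 0"
      using True by (intro ker) auto
    finally show ?thesis
      using kappa(1) by simp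
  qed (simp add: dot_f coeff_tail_q)
  then have qf: "dot3 q f = 0"
    by (intro poly_eqI) simp
  have "coeff (dot3 p f) k = 0" for k
  proof (cases "k < \<mu>")
    case True
    have "- kappa * coeff (dot3 p f) k = (\<Sum>j<n. v $ j * trans_mat $$ (j, n - 1 - k))"
      unfolding dot_f sum_distrib_left using True mu_le by (intro sum.cong) (auto simp: trans_mat_def)
    also have "\<dots> = 0"
      using True mu_le by (intro ker) auto
    finally show ?thesis
      using kappa(1) by simp
  qed (simp add: dot_f coeff_tail_p)
  then have pf: "dot3 p f = 0"
    by (intro poly_eqI) simp
  have "cross3 \<phi> f i = 0" if "i < 3" for i
    using that by (simp add: cross3_phi pf qf)
  then have f: "f i = dot3 u f * \<phi> i" if "i < 3" for i
    using parallel_unimodular[OF unimodular] that by blast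
  obtain a where a: "a < 3" "degree (\<phi> a) = n"
    using degree_eq by blast
  then have phi_a: "coeff (\<phi> a) n \<noteq> 0" "\<phi> a \<noteq> 0"
    using n_pos leading_coeff_0_iff[of "\<phi> a"] by auto
  have coeff_f: "coeff (f a) k = (\<Sum>j<n. v $ j * coeff (\<phi> a) (k + Suc j))" for k
    by (simp add: f_def coeff_sum coeff_poly_shift)
  \<comment> \<open>A multiple of \<open>\<phi> a\<close> of degree below \<open>n\<close> must be
    zero.\<close>
  have "degree (f a) < n"
    using n_pos by (intro degree_lessI) (auto simp: coeff_f coeff_eq_0 a)
  then have "dot3 u f = 0"
    using f[OF a(1)] a phi_a degree_mult_eq[of "dot3 u f" "\<phi> a"] by force
  then have f0: "f a = 0"
    using f a by simp
  have "v $ m = 0" if "m < n" for m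
    using that
  proof (induction m rule: less_induct)
    case (less m)
    \<comment> \<open>The coefficients of \<open>f a\<close> in degrees \<open>n - 1\<close>,
      \<open>n - 2\<close>, ... form a triangular system with diagonal entry
      \<open>coeff (\<phi> a) n\<close>: terms with \<open>j > m\<close> exceed the degree, those
      with \<open>j < m\<close> vanish by induction.\<close>
    have "0 = (\<Sum>j<n. v $ j * coeff (\<phi> a) (n - 1 - m + Suc j))"
      using coeff_f[of "n - 1 - m"] f0 by simp
    also have "\<dots> = (\<Sum>j<n. if j = m then v $ m * coeff (\<phi> a) n else 0)"
    proof (intro sum.cong refl)
      fix j assume "j \<in> {..<n}"
      then show "v $ j * coeff (\<phi> a) (n - 1 - m + Suc j) = (if j = m then v $ m * coeff (\<phi> a) n else 0)"
        using less by (cases j m rule: linorder_cases) (auto simp: coeff_eq_0 a)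
    qed
    also have "\<dots> = v $ m * coeff (\<phi> a) n"
      using less by simp
    finally show ?case
      using phi_a by simp
  qed
  then have "v = 0\<^sub>v n"
    using v(1) by (intro eq_vecI) auto
  with v(2) show False by simp
qed

lemma sum_mult_coeff_truncate:
  assumes "\<And>k. m \<le> k \<Longrightarrow> coeff b k = 0"
  shows "(\<Sum>k<m. coeff b k * (if k \<le> i then coeff f (i - k) else 0)) = coeff (b * f) i"
proof -
  have "(\<Sum>k<m. coeff b k * (if k \<le> i then coeff f (i - k) else 0)) =
      (\<Sum>k\<in>{..<m} \<inter> {..i}. coeff b k * coeff f (i - k))"
    by (rule sum.mono_neutral_cong_right) auto
  also have "\<dots> = (\<Sum>k\<le>i. coeff b k * coeff f (i - k))"
    by (intro sum.mono_neutral_left) (auto, metis assms mult_zero_left not_le)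
  finally show ?thesis
    by (simp add: coeff_mult)
qed

text \<open>\<open>cross3_phi\<close> read coefficientwise, one coordinate \<open>e\<close> at a
  time. Column \<open>n - 1 - i\<close> appears because Sylvester columns run through descending
  powers.\<close>

lemma cross_tail_eq_sylvester:
  assumes e: "e < 3" and ij: "i < n" "j < n"
  shows "coeff (- cross3 \<phi> (tail_phi j) e) i =
    (\<Sum>r<n. trans_mat $$ (j, r) * sylvester2 \<mu> (n - \<mu>) (coeff (p e)) (coeff (q e)) $$ (r, n - 1 - i))"
    (is "_ = (\<Sum>r<n. ?T r * ?S r)")
proof -
  let ?A = "dot3 p (tail_phi j)" and ?B = "dot3 q (tail_phi j)"
  have p: "coeff (p e) k = 0" if "\<mu> < k" for k
    using degree_p[OF e] that by (intro coeff_eq_0) simp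
  have q: "coeff (q e) k = 0" if "n - \<mu> < k" for k
    using degree_q[OF e] that by (intro coeff_eq_0) simp
  \<comment> \<open>Row \<open>n - \<mu> - 1 - k\<close> holds the coefficients of
    \<open>x^k\<close> times \<open>p e\<close>.\<close>
  have "(\<Sum>r<n - \<mu>. ?T r * ?S r) =
      (\<Sum>k<n - \<mu>. kappa * (coeff ?B k * (if k \<le> i then coeff (p e) (i - k) else 0)))"
    by (rule sum.reindex_bij_witness[of _ "\<lambda>k. n - \<mu> - 1 - k" "\<lambda>k. n - \<mu> - 1 - k"])
      (use ij mu_le p in \<open>auto simp: trans_mat_def sylvester2_def intro!: arg_cong[of _ _ "coeff (p e)"]\<close>)
  also have "\<dots> = kappa * coeff (p e * ?B) i"
    by (simp only: sum_distrib_left[symmetric] sum_mult_coeff_truncate[OF coeff_tail_q] mult.commute)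
  finally have 1: "(\<Sum>r<n - \<mu>. ?T r * ?S r) = kappa * coeff (p e * ?B) i" .
  \<comment> \<open>Row \<open>n - 1 - k\<close> holds the coefficients of \<open>x^k\<close> times
    \<open>q e\<close>.\<close>
  have "(\<Sum>r\<in>{n - \<mu>..<n}. ?T r * ?S r) =
      (\<Sum>k<\<mu>. - kappa * (coeff ?A k * (if k \<le> i then coeff (q e) (i - k) else 0)))"
    by (rule sum.reindex_bij_witness[of _ "\<lambda>k. n - 1 - k" "\<lambda>r. n - 1 - r"])
      (use ij mu_le q in \<open>auto simp: trans_mat_def sylvester2_def intro!: arg_cong[of _ _ "coeff (q e)"]\<close>)
  also have "\<dots> = - kappa * coeff (q e * ?A) i"
    by (simp only: sum_distrib_left[symmetric] sum_mult_coeff_truncate[OF coeff_tail_p] mult.commute)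
  finally have 2: "(\<Sum>r\<in>{n - \<mu>..<n}. ?T r * ?S r) = - kappa * coeff (q e * ?A) i" .
  have split: "{..<n} = {..<n - \<mu>} \<union> {n - \<mu>..<n}"
    by auto
  have "(\<Sum>r<n. ?T r * ?S r) = (\<Sum>r<n - \<mu>. ?T r * ?S r) + (\<Sum>r\<in>{n - \<mu>..<n}. ?T r * ?S r)"
    by (subst split, intro sum.union_disjoint) auto
  then show ?thesis
    unfolding 1 2 by (simp add: cross3_phi[OF e] algebra_simps)
qed

end

section \<open>Binary forms\<close>

lemma const2_simps:
  "const2 0 = 0" "const2 1 = 1" "const2 (x + y) = const2 x + const2 y"
  "const2 (x - y) = const2 x - const2 y" "const2 (x * y) = const2 x * const2 y"
  by (simp_all add: const2_def one_pCons)

lemma const2_sum: "const2 (sum f A) = (\<Sum>x\<in>A. const2 (f x))"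
  by (induction A rule: infinite_finite_induct) (simp_all add: const2_simps)

abbreviation form_X :: bpoly where "form_X \<equiv> [:[:0, 1:]:]"
abbreviation form_Y :: bpoly where "form_Y \<equiv> [:0, 1:]"

lemma homog_expand:
  assumes "homog m f"
  shows "f = (\<Sum>k\<le>m. const2 (hcoeff f m k) * form_X ^ k * form_Y ^ (m - k))"
proof -
  have X: "form_X ^ k = [:monom 1 k:]" for k
    by (induction k) (simp_all add: monom_Suc one_pCons monom_0)
  have Y: "form_Y ^ k = monom 1 k" for k
    by (simp add: monom_altdef)
  have eq: "const2 z * form_X ^ k * form_Y ^ l = monom (monom z k) l" for z k l
    unfolding X Y by (simp add: const2_def smult_monom)
  have "coeff (coeff f j) i = coeff (coeff (\<Sum>k\<le>m. monom (monom (hcoeff f m k) k) (m - k)) j) i" for i j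
  proof -
    have "coeff (coeff (\<Sum>k\<le>m. monom (monom (hcoeff f m k) k) (m - k)) j) i =
        (\<Sum>k\<le>m. if k = i then (if m - k = j then hcoeff f m k else 0) else 0)"
      unfolding coeff_sum by (intro sum.cong) auto
    also have "\<dots> = (if i \<le> m \<and> m - i = j then hcoeff f m i else 0)"
      by simp
    also have "\<dots> = coeff (coeff f j) i"
      using assms unfolding homog_def hcoeff_def by fastforce
    finally show ?thesis ..
  qed
  then show ?thesis
    unfolding eq by (intro poly_eqI)
qed

lemma homog_mult:
  assumes "homog m f" "homog m' g"
  shows "homog (m + m') (f * g)"
  unfolding homog_def
proof (intro allI impI)
  fix j k assume "coeff (coeff (f * g) j) k \<noteq> 0"
  then have "(\<Sum>i\<le>j. coeff (coeff f i * coeff g (j - i)) k) \<noteq> 0"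
    by (simp add: coeff_mult coeff_sum)
  then obtain i where i: "i \<le> j" "coeff (coeff f i * coeff g (j - i)) k \<noteq> 0"
    using sum.neutral by (metis (no_types, lifting) atMost_iff)
  then obtain l where l: "l \<le> k" "coeff (coeff f i) l * coeff (coeff g (j - i)) (k - l) \<noteq> 0"
    unfolding coeff_mult using sum.neutral by (metis (no_types, lifting) atMost_iff)
  then have "i + l = m" "j - i + (k - l) = m'"
    using assms unfolding homog_def by auto
  then show "j + k = m + m'"
    using i l by simp
qed

lemma homog_diff:
  assumes "homog m f" "homog m g"
  shows "homog m (f - g)"
  using assms unfolding homog_def by (metis coeff_diff diff_zero)

section \<open>Dehomogenization and linear factors of binary forms\<close>

definition dehom :: "bpoly \<Rightarrow> complex poly" where
  "dehom f = poly f 1"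

lemma dehom_simps:
  "dehom (f + g) = dehom f + dehom g" "dehom (f - g) = dehom f - dehom g"
  "dehom (f * g) = dehom f * dehom g" "dehom 0 = 0"
  by (simp_all add: dehom_def)

lemma dehom_sum: "dehom (sum f A) = (\<Sum>x\<in>A. dehom (f x))"
  by (simp add: dehom_def poly_sum)

lemma coeff_dehom:
  assumes "homog m f"
  shows "coeff (dehom f) k = (if k \<le> m then hcoeff f m k else 0)"
proof -
  have X: "[:0, 1:] ^ k = monom (1 :: complex) k" for k
    by (induction k) (simp_all add: monom_Suc one_pCons monom_0)
  have "dehom f = (\<Sum>k\<le>m. monom (hcoeff f m k) k)"
    by (subst homog_expand[OF assms]) (simp add: dehom_def poly_sum poly_power const2_def X smult_monom)
  then show ?thesis
    by (simp add: coeff_sum)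
qed

lemma degree_dehom_le: "homog m f \<Longrightarrow> degree (dehom f) \<le> m"
  by (rule degree_le) (simp add: coeff_dehom)

text \<open>In a fixed degree, distinct monomials stay distinct when the outer variable is set to
  1.\<close>

lemma dehom_eq_0:
  assumes "homog m f" "dehom f = 0"
  shows "f = 0"
proof -
  have "hcoeff f m k = 0" if "k \<le> m" for k
    using coeff_dehom[OF assms(1), of k] that assms(2) by simp
  then show ?thesis
    by (subst homog_expand[OF assms(1)]) (simp add: const2_simps)
qed

text \<open>Subtract \<open>f(z, 1) Y^m = 0\<close> from \<open>f\<close>; what remains is a
  combination of the differences \<open>X^k - (z Y)^k\<close>, each divisible by
  \<open>X - z Y\<close>.\<close>

lemma linear_form_dvd:
  assumes f: "homog m f" and z: "poly (dehom f) z = 0"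
  shows "form_X - const2 z * form_Y dvd f"
proof -
  let ?L = "form_X - const2 z * form_Y"
  have "const2 (poly (dehom f) z) = (\<Sum>k\<le>m. const2 (hcoeff f m k) * const2 z ^ k)"
  proof -
    have "poly (dehom f) z = (\<Sum>k\<le>m. hcoeff f m k * z ^ k)"
      by (subst poly_as_sum_of_monoms'[OF degree_dehom_le[OF f], symmetric])
        (simp add: poly_sum poly_monom coeff_dehom[OF f])
    moreover have "const2 (z ^ k) = const2 z ^ k" for k
      by (induction k) (simp_all add: const2_simps)
    ultimately show ?thesis
      by (simp add: const2_sum const2_simps)
  qed
  then have "(\<Sum>k\<le>m. const2 (hcoeff f m k) * const2 z ^ k) * form_Y ^ m = 0"
    using z by (simp add: const2_simps)
  then have "f = (\<Sum>k\<le>m. const2 (hcoeff f m k) * form_X ^ k * form_Y ^ (m - k)) -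
      (\<Sum>k\<le>m. const2 (hcoeff f m k) * const2 z ^ k) * form_Y ^ m"
    using homog_expand[OF f] by simp
  also have "\<dots> = (\<Sum>k\<le>m. const2 (hcoeff f m k) * form_Y ^ (m - k) *
      (form_X ^ k - (const2 z * form_Y) ^ k))"
    unfolding sum_distrib_right sum_subtractf[symmetric]
  proof (intro sum.cong refl)
    fix k assume "k \<in> {..m}"
    then have "form_Y ^ m = form_Y ^ (m - k) * form_Y ^ k"
      by (simp flip: power_add)
    then show "const2 (hcoeff f m k) * form_X ^ k * form_Y ^ (m - k) -
        const2 (hcoeff f m k) * const2 z ^ k * form_Y ^ m =
      const2 (hcoeff f m k) * form_Y ^ (m - k) * (form_X ^ k - (const2 z * form_Y) ^ k)"
      by (simp only: power_mult_distrib right_diff_distrib mult_ac)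
  qed
  finally have f: "f = \<dots>" .
  have "?L dvd form_X ^ k - (const2 z * form_Y) ^ k" for k
    by (subst power_diff_sumr2) (rule dvd_triv_left)
  then show ?thesis
    by (subst f) (intro dvd_sum dvd_mult)
qed

lemma form_Y_dvd:
  assumes f: "homog m f" and "hcoeff f m m = 0"
  shows "form_Y dvd f"
proof -
  have "coeff f 0 = 0"
  proof (rule poly_eqI)
    fix k
    show "coeff (coeff f 0) k = coeff 0 k"
      using assms unfolding homog_def hcoeff_def by (metis add_0 coeff_0 diff_self_eq_0)
  qed
  then obtain g where "f = form_Y * g"
    by (cases f) auto
  then show ?thesis ..
qed

text \<open>The gcd has no root, so it is a nonzero constant by the fundamental theorem of algebra;
  two Bezout relations are then composed and rescaled.\<close>

lemma unimodular_of_no_common_root: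
  fixes f :: "nat \<Rightarrow> complex poly"
  assumes "\<And>z. \<exists>i<3. poly (f i) z \<noteq> 0"
  obtains u where "dot3 u f = 1"
proof -
  obtain s t where st: "s * f 1 + t * f 2 = gcd (f 1) (f 2)"
    using bezout_coefficients_fst_snd[of "f 1" "f 2"] by blast
  obtain s' t' where st': "s' * f 0 + t' * gcd (f 1) (f 2) = gcd (f 0) (gcd (f 1) (f 2))"
    using bezout_coefficients_fst_snd[of "f 0" "gcd (f 1) (f 2)"] by blast
  define g where "g = gcd (f 0) (gcd (f 1) (f 2))"
  have dvd: "g dvd f i" if "i < 3" for i
    using that by (auto simp: less_3_cases g_def intro: dvd_trans)
  have "poly g z \<noteq> 0" for z
    using assms[of z] dvd by (metis dvd_def mult_zero_left poly_mult)
  then have "constant (poly g)"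
    using fundamental_theorem_of_algebra by blast
  then have "degree g = 0"
    by (simp add: constant_degree)
  then obtain e where e: "g = [:e:]"
    by (rule degree_eq_zeroE)
  have "e \<noteq> 0"
    using \<open>\<And>z. poly g z \<noteq> 0\<close>[of 0] e by simp
  define u where "u i = [:1 / e:] * (if i = 0 then s' else if i = 1 then t' * s else t' * t)" for i :: nat
  have "dot3 u f = [:1 / e:] * (s' * f 0 + t' * (s * f 1 + t * f 2))"
    unfolding dot3_def sum_lessThan_3 u_def by (simp only: algebra_simps) (simp add: algebra_simps)
  also have "\<dots> = 1"
    unfolding st st' using \<open>e \<noteq> 0\<close> e unfolding g_def[symmetric] by simp
  finally show thesis
    by (rule that)
qed

section \<open>Bezout and Sylvester matrices over the ring of binary forms\<close>

lemma bezout2_common_third: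
  fixes a b c :: "'a::comm_ring_1"
  assumes "i < n" "j < n"
  shows "bezout2 n (\<lambda>k. A k * c - C k * a) (\<lambda>k. B k * c - C k * b) $$ (i, j) =
    c * (bezout2 n B C $$ (i, j) * a + bezout2 n C A $$ (i, j) * b + bezout2 n A B $$ (i, j) * c)"
  \<comment> \<open>Bezout matrices are bilinear and alternating: the term pairing \<open>C\<close>
    with itself vanishes and all others carry a factor \<open>c\<close>.\<close>
  using assms
  by (simp add: bezout2_def sum_distrib_left sum_distrib_right sum.distrib[symmetric])
    (intro sum.cong, auto simp: algebra_simps)

lemma bezout2_const2:
  assumes "i < n" "j < n" "\<And>k. k \<le> n \<Longrightarrow> A k = coeff f k" "\<And>k. k \<le> n \<Longrightarrow> B k = coeff g k"
  shows "bezout2 n (\<lambda>k. const2 (A k)) (\<lambda>k. const2 (B k)) $$ (i, j) =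
    const2 (bezout2 n (coeff f) (coeff g) $$ (i, j))"
  using assms by (auto simp: bezout2_def const2_sum const2_simps intro!: sum.cong)

lemma sum_banded_row:
  fixes P w :: "nat \<Rightarrow> 'a::comm_ring_1"
  assumes "r + m < n"
  shows "(\<Sum>j<n. (if r \<le> j \<and> j \<le> r + m then P (m - (j - r)) else 0) * w j) =
    (\<Sum>k\<le>m. P k * w (r + m - k))"
proof -
  have "(\<Sum>j<n. (if r \<le> j \<and> j \<le> r + m then P (m - (j - r)) else 0) * w j) =
      (\<Sum>j\<in>{r..r + m}. P (m - (j - r)) * w j)"
    using assms by (intro sum.mono_neutral_cong_right) auto
  also have "\<dots> = (\<Sum>k\<le>m. P k * w (r + m - k))"
    by (rule sum.reindex_bij_witness[of _ "\<lambda>k. r + m - k" "\<lambda>j. r + m - j"]) (auto simp: ac_simps)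
  finally show ?thesis .
qed

text \<open>Pairing a Sylvester row with the monomials of degree \<open>n - 1\<close> substitutes
  \<open>(t, u)\<close> for \<open>(s, v)\<close>, giving a monomial times the syzygy
  relation.\<close>

lemma phi_coeff_row_eq_0:
  assumes h: "\<And>i. i < 3 \<Longrightarrow> homog m (h i)" and syz: "syzygy a b c h" and r: "r + m < n"
  shows "(\<Sum>j<n. (if r \<le> j \<and> j \<le> r + m then phi_coeff a b c h m (m - (j - r)) else 0) *
    (form_X ^ (n - 1 - j) * form_Y ^ j)) = 0"
proof -
  have "(\<Sum>k\<le>m. phi_coeff a b c h m k * (form_X ^ (n - 1 - (r + m - k)) * form_Y ^ (r + m - k))) =
      (\<Sum>k\<le>m. form_X ^ (n - 1 - (r + m)) * form_Y ^ r *
        (phi_coeff a b c h m k * (form_X ^ k * form_Y ^ (m - k))))"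
  proof (intro sum.cong refl)
    fix k assume "k \<in> {..m}"
    then have "n - 1 - (r + m - k) = n - 1 - (r + m) + k" "r + m - k = r + (m - k)"
      using r by auto
    then show "phi_coeff a b c h m k * (form_X ^ (n - 1 - (r + m - k)) * form_Y ^ (r + m - k)) =
        form_X ^ (n - 1 - (r + m)) * form_Y ^ r * (phi_coeff a b c h m k * (form_X ^ k * form_Y ^ (m - k)))"
      by (simp only: power_add mult_ac)
  qed
  also have "\<dots> = form_X ^ (n - 1 - (r + m)) * form_Y ^ r *
      (\<Sum>k\<le>m. \<Sum>i<3. const2 (hcoeff (h i) m k) * form_X ^ k * form_Y ^ (m - k) * phi3 a b c i)"
    unfolding phi_coeff_def sum_distrib_left sum_distrib_right by (intro sum.cong refl) (simp only: mult_ac)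
  also have "(\<Sum>k\<le>m. \<Sum>i<3. const2 (hcoeff (h i) m k) * form_X ^ k * form_Y ^ (m - k) * phi3 a b c i) =
      (\<Sum>i<3. h i * phi3 a b c i)"
    by (subst sum.swap) (intro sum.cong refl, simp only: sum_distrib_right[symmetric], subst homog_expand[OF h], auto)
  also have "\<dots> = 0"
    using syz by (simp add: syzygy_def)
  finally show ?thesis
    by (simp only: mult_zero_right sum_banded_row[OF r, of "phi_coeff a b c h m" "\<lambda>j. form_X ^ (n - 1 - j) * form_Y ^ j"])
qed

lemma det_sylvester_syzygies_eq_0:
  assumes p: "\<And>i. i < 3 \<Longrightarrow> homog m1 (p i)" "syzygy a b c p"
    and q: "\<And>i. i < 3 \<Longrightarrow> homog m2 (q i)" "syzygy a b c q"
    and pos: "0 < m1 + m2"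
  shows "det (sylvester2 m1 m2 (phi_coeff a b c p m1) (phi_coeff a b c q m2)) = 0"
proof -
  let ?n = "m1 + m2"
  let ?S = "sylvester2 m1 m2 (phi_coeff a b c p m1) (phi_coeff a b c q m2)"
  let ?w = "\<lambda>j. form_X ^ (?n - 1 - j) * form_Y ^ j"
  have S: "?S \<in> carrier_mat ?n ?n"
    by (simp add: sylvester2_def)
  have "?S *\<^sub>v vec ?n ?w = 0\<^sub>v ?n"
  proof (rule eq_vecI)
    fix r assume "r < dim_vec (0\<^sub>v ?n :: bpoly vec)"
    then have r: "r < ?n" by simp
    have "(?S *\<^sub>v vec ?n ?w) $ r = (\<Sum>j<?n. ?S $$ (r, j) * ?w j)"
      using r S by (simp add: scalar_prod_def atLeast0LessThan)
    also have "\<dots> = 0"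
    proof (cases "r < m2")
      case True
      then show ?thesis
        using phi_coeff_row_eq_0[OF p, of r ?n] r by (simp add: sylvester2_def)
    next
      case False
      then show ?thesis
        using phi_coeff_row_eq_0[OF q, of "r - m2" ?n] r by (simp add: sylvester2_def)
    qed
    finally show "(?S *\<^sub>v vec ?n ?w) $ r = 0\<^sub>v ?n $ r"
      using r by simp
  qed (use S in auto)
  \<comment> \<open>The last entry is a power of \<open>form_Y\<close>.\<close>
  moreover have "vec ?n ?w \<noteq> 0\<^sub>v ?n"
  proof
    assume "vec ?n ?w = 0\<^sub>v ?n"
    then have "vec ?n ?w $ (?n - 1) = 0\<^sub>v ?n $ (?n - 1)"
      by (rule arg_cong)
    then show False
      using pos by simp
  qed
  ultimately show ?thesis
    using det_0_iff_vec_prod_zero[OF S] by (blast intro: vec_carrier)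
qed

section \<open>The factorization of the Bezout matrix\<close>

lemma no_common_root:
  assumes f: "\<And>i. i < 3 \<Longrightarrow> homog n (f i)"
    and coprime: "\<And>h. (\<And>i. i < 3 \<Longrightarrow> h dvd f i) \<Longrightarrow> is_unit h"
  shows "\<exists>i<3. poly (dehom (f i)) z \<noteq> 0"
proof (rule ccontr)
  assume "\<not> ?thesis"
  then have "is_unit (form_X - const2 z * form_Y)"
    using f by (intro coprime linear_form_dvd) auto
  then obtain g where "1 = (form_X - const2 z * form_Y) * g" ..
  \<comment> \<open>A unit cannot vanish at the point \<open>X = z\<close>,
    \<open>Y = 1\<close>.\<close>
  then have "poly (dehom 1) z = poly (dehom ((form_X - const2 z * form_Y) * g)) z"
    by (rule arg_cong)
  then show False
    by (simp add: dehom_def const2_def)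
qed

text \<open>The case of the point at infinity: if every degree dropped, \<open>form_Y\<close> would
  be a common factor.\<close>

lemma exists_degree_eq:
  assumes f: "\<And>i. i < 3 \<Longrightarrow> homog n (f i)"
    and coprime: "\<And>h. (\<And>i. i < 3 \<Longrightarrow> h dvd f i) \<Longrightarrow> is_unit h"
  shows "\<exists>i<3. degree (dehom (f i)) = n"
proof (rule ccontr)
  assume contra: "\<not> ?thesis"
  have "form_Y dvd f i" if i: "i < 3" for i
  proof -
    have "degree (dehom (f i)) < n"
      using contra i degree_dehom_le[OF f[OF i]] by (simp add: le_neq_implies_less)
    then have "hcoeff (f i) n n = 0"
      using coeff_dehom[OF f[OF i], of n] by (simp add: coeff_eq_0)
    then show ?thesis
      by (rule form_Y_dvd[OF f[OF i]])
  qed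
  then have "is_unit form_Y"
    by (rule coprime)
  then obtain g where "1 = form_Y * g" ..
  then have "coeff 1 0 = coeff (form_Y * g) 0"
    by (rule arg_cong)
  then show False
    by simp
qed

text \<open>If the cross product vanished, the multipliers \<open>q j\<close> and
  \<open>- p j\<close> would give a relation for each \<open>j\<close>, forcing
  \<open>p = q = 0\<close>, which the relation with multipliers 1 and 1 then refutes.\<close>

lemma cross3_mu_basis_neq_0:
  assumes ind: "\<And>\<alpha> \<beta>. \<forall>i<3. \<alpha> * p i + \<beta> * q i = 0 \<Longrightarrow> \<alpha> = 0 \<and> \<beta> = (0 :: bpoly)"
  shows "\<exists>i<3. cross3 p q i \<noteq> 0"
proof (rule ccontr)
  assume "\<not> ?thesis"
  then have par: "p i * q j = p j * q i" if "i < 3" "j < 3" for i j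
    using cross3_eq_0_iff[of p q] that by blast
  have "p j = 0 \<and> q j = 0" if "j < 3" for j
    using ind[of "q j" "- p j"] par[OF _ that] by (simp add: mult.commute)
  then show False
    using ind[of 1 1] by simp
qed

lemma mu_basisD:
  assumes "mu_basis a b c n \<mu> p q"
  shows "\<mu> \<le> n" "i < 3 \<Longrightarrow> homog \<mu> (p i)" "i < 3 \<Longrightarrow> homog (n - \<mu>) (q i)"
    "syzygy a b c p" "syzygy a b c q"
    "\<forall>i<3. \<alpha> * p i + \<beta> * q i = 0 \<Longrightarrow> \<alpha> = 0 \<and> \<beta> = 0"
proof -
  show "\<mu> \<le> n"
    using assms unfolding mu_basis_def by linarith
qed (use assms in \<open>unfold mu_basis_def, blast+\<close>)

lemma plane_mu_basis_dehom:
  assumes n: "0 < n"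
    and abc: "homog n a" "homog n b" "homog n c"
    and coprime: "\<And>h. h dvd a \<Longrightarrow> h dvd b \<Longrightarrow> h dvd c \<Longrightarrow> is_unit h"
    and mub: "mu_basis a b c n \<mu> p q"
  obtains u where
    "plane_mu_basis (\<lambda>i. dehom (phi3 a b c i)) (\<lambda>i. dehom (p i)) (\<lambda>i. dehom (q i)) u n \<mu>"
proof -
  let ?\<phi> = "phi3 a b c"
  have phi: "homog n (?\<phi> i)" for i
    using abc by (simp add: phi3_def)
  have coprime': "is_unit h" if "\<And>i. i < 3 \<Longrightarrow> h dvd ?\<phi> i" for h
    using that[of 0] that[of 1] that[of 2] by (intro coprime) (simp_all add: phi3_def)
  note mu = mu_basisD(1)[OF mub] and p = mu_basisD(2)[OF mub] and q = mu_basisD(3)[OF mub]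
  have syz: "dot3 (\<lambda>i. dehom (h i)) (\<lambda>i. dehom (?\<phi> i)) = 0" if "syzygy a b c h" for h
  proof -
    have "dehom (\<Sum>i<3. h i * ?\<phi> i) = 0"
      using that by (simp add: syzygy_def dehom_simps)
    then show ?thesis
      by (simp add: dot3_def dehom_sum dehom_simps)
  qed
  obtain e where e: "e < 3" "cross3 p q e \<noteq> 0"
    using cross3_mu_basis_neq_0[OF mu_basisD(6)[OF mub]] by blast
  \<comment> \<open>Homogeneity is what keeps the nonzero component nonzero after
    dehomogenization.\<close>
  have "homog (\<mu> + (n - \<mu>)) (cross3 p q e)"
    unfolding cross3_def
    by (intro homog_diff homog_mult p q) simp_all
  then have "dehom (cross3 p q e) \<noteq> 0"
    using e(2) dehom_eq_0 by metis
  then have cross: "cross3 (\<lambda>i. dehom (p i)) (\<lambda>i. dehom (q i)) e \<noteq> 0"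
    by (simp add: cross3_def dehom_simps)
  have "\<exists>i<3. poly (dehom (?\<phi> i)) z \<noteq> 0" for z
    by (rule no_common_root[OF phi coprime'])
  then obtain u where "dot3 u (\<lambda>i. dehom (?\<phi> i)) = 1"
    by (rule unimodular_of_no_common_root)
  moreover have "\<exists>i<3. degree (dehom (?\<phi> i)) = n"
    by (rule exists_degree_eq[OF phi coprime'])
  ultimately have "plane_mu_basis (\<lambda>i. dehom (?\<phi> i)) (\<lambda>i. dehom (p i)) (\<lambda>i. dehom (q i)) u n \<mu>"
    using n mu phi p q cross e syz[OF mu_basisD(4)[OF mub]] syz[OF mu_basisD(5)[OF mub]]
    by unfold_locales (blast intro: degree_dehom_le)+
  then show thesis
    by (rule that)
qed

text \<open>The rows of \<^const>\<open>bezout2\<close> are indexed by ascending powers of \<open>s\<close>, the columns of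
  \<^const>\<open>sylvester2\<close> by descending ones.\<close>
definition flip_mat :: "nat \<Rightarrow> 'a::comm_ring_1 mat" where
  "flip_mat n = mat n n (\<lambda>(i, j). if i + j = n - 1 then 1 else 0)"

lemma flip_mat_carrier [simp]: "flip_mat n \<in> carrier_mat n n"
  by (simp add: flip_mat_def)

lemma mult_flip_mat:
  assumes "A \<in> carrier_mat m n" "i < m" "j < n"
  shows "(A * flip_mat n) $$ (i, j) = A $$ (i, n - 1 - j)"
proof -
  have "(A * flip_mat n) $$ (i, j) = (\<Sum>k<n. A $$ (i, k) * (if k + j = n - 1 then 1 else 0))"
    using assms by (simp add: scalar_prod_def flip_mat_def atLeast0LessThan)
  also have "\<dots> = (\<Sum>k<n. if k = n - 1 - j then A $$ (i, k) else 0)"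
    using assms by (intro sum.cong) auto
  finally show ?thesis
    using assms by simp
qed

lemma flip_mat_involution: "flip_mat n * flip_mat n = 1\<^sub>m n"
proof (rule eq_matI)
  fix i j assume "i < dim_row (1\<^sub>m n :: 'a mat)" "j < dim_col (1\<^sub>m n :: 'a mat)"
  then show "(flip_mat n * flip_mat n) $$ (i, j) = (1\<^sub>m n :: 'a mat) $$ (i, j)"
    by (subst mult_flip_mat[of _ n]) (auto simp: flip_mat_def)
qed (simp_all add: flip_mat_def)

abbreviation (input) bezout_FG :: "nat \<Rightarrow> bpoly \<Rightarrow> bpoly \<Rightarrow> bpoly \<Rightarrow> bpoly mat" where
  "bezout_FG n a b c \<equiv> bezout2 n (\<lambda>k. const2 (hcoeff a n k) * c - const2 (hcoeff c n k) * a)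
     (\<lambda>k. const2 (hcoeff b n k) * c - const2 (hcoeff c n k) * b)"

abbreviation (input) sylvester_pq ::
    "nat \<Rightarrow> bpoly \<Rightarrow> bpoly \<Rightarrow> bpoly \<Rightarrow> nat \<Rightarrow> (nat \<Rightarrow> bpoly) \<Rightarrow> (nat \<Rightarrow> bpoly) \<Rightarrow> bpoly mat" where
  "sylvester_pq n a b c \<mu> p q \<equiv>
     sylvester2 \<mu> (n - \<mu>) (phi_coeff a b c p \<mu>) (phi_coeff a b c q (n - \<mu>))"

text \<open>The minus sign reconciles the orientation of \<open>bezout2_eq_coeff\<close> with that
  of \<open>cross3\<close>.\<close>

lemma bezout_FG_index:
  assumes abc: "homog n a" "homog n b" "homog n c" and ij: "i < n" "j < n"
  shows "bezout_FG n a b c $$ (i, j) = c * (\<Sum>e<3.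
    const2 (coeff (- cross3 (\<lambda>i. dehom (phi3 a b c i)) (\<lambda>i. tail j (dehom (phi3 a b c i))) e) i) * phi3 a b c e)"
proof -
  have *: "bezout2 n (\<lambda>k. const2 (hcoeff f n k)) (\<lambda>k. const2 (hcoeff g n k)) $$ (i, j) =
      const2 (coeff (dehom g * tail j (dehom f) - dehom f * tail j (dehom g)) i)"
    if "homog n f" "homog n g" for f g
    using that ij
    by (simp add: bezout2_const2[of _ n _ _ "dehom f" _ "dehom g"] coeff_dehom bezout2_eq_coeff degree_dehom_le
        del: coeff_diff)
  show ?thesis
    unfolding bezout2_common_third[OF ij] *[OF abc(2,3)] *[OF abc(3,1)] *[OF abc(1,2)]
      sum_lessThan_3 cross3_simps
    by (simp add: phi3_def algebra_simps)
qed

lemma sylvester_pq_index: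
  assumes p: "\<And>e. e < 3 \<Longrightarrow> homog \<mu> (p e)" and q: "\<And>e. e < 3 \<Longrightarrow> homog (n - \<mu>) (q e)"
    and ij: "\<mu> \<le> n" "i < n" "j < n"
  shows "sylvester_pq n a b c \<mu> p q $$ (i, j) = (\<Sum>e<3.
    const2 (sylvester2 \<mu> (n - \<mu>) (coeff (dehom (p e))) (coeff (dehom (q e))) $$ (i, j)) * phi3 a b c e)"
  using ij by (auto simp: sylvester2_def phi_coeff_def const2_simps coeff_dehom[OF p] coeff_dehom[OF q]
      intro!: sum.cong)

text \<open>The transpose is taken because rows of \<open>trans_mat\<close> are indexed by powers of
  \<open>y\<close>, which index the columns of \<open>bezout2\<close>.\<close>

lemma bezout_FG_factorization:
  assumes abc: "homog n a" "homog n b" "homog n c"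
    and mub: "mu_basis a b c n \<mu> p q"
    and pmb: "plane_mu_basis (\<lambda>i. dehom (phi3 a b c i)) (\<lambda>i. dehom (p i)) (\<lambda>i. dehom (q i)) u n \<mu>"
  shows "transpose_mat (bezout_FG n a b c) = c \<cdot>\<^sub>m
    (map_mat const2 (plane_mu_basis.trans_mat (\<lambda>i. dehom (phi3 a b c i)) (\<lambda>i. dehom (p i)) (\<lambda>i. dehom (q i)) n \<mu>)
      * sylvester_pq n a b c \<mu> p q * flip_mat n)"
proof -
  interpret plane_mu_basis "\<lambda>i. dehom (phi3 a b c i)" "\<lambda>i. dehom (p i)" "\<lambda>i. dehom (q i)" u n \<mu>
    by (rule pmb)
  let ?S = "sylvester_pq n a b c \<mu> p q" and ?T = "map_mat const2 trans_mat"
  note p = mu_basisD(2)[OF mub] and q = mu_basisD(3)[OF mub]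
  have S: "?S \<in> carrier_mat n n"
    using mu_le by (simp add: sylvester2_def)
  have T: "?T \<in> carrier_mat n n"
    by (simp add: trans_mat_def)
  show ?thesis
  proof (rule eq_matI)
    fix j i assume "j < dim_row (c \<cdot>\<^sub>m (?T * ?S * flip_mat n))" "i < dim_col (c \<cdot>\<^sub>m (?T * ?S * flip_mat n))"
    then have ij: "j < n" "i < n"
      using T by (simp_all add: flip_mat_def)
    have "(?T * ?S * flip_mat n) $$ (j, i) = (?T * ?S) $$ (j, n - 1 - i)"
      using ij T S by (intro mult_flip_mat[of _ n]) auto
    also have "\<dots> = (\<Sum>r<n. const2 (trans_mat $$ (j, r)) * ?S $$ (r, n - 1 - i))"
      using ij T S by (simp add: scalar_prod_def atLeast0LessThan)
    also have "\<dots> = (\<Sum>r<n. \<Sum>e<3. const2 (trans_mat $$ (j, r) * sylvester2 \<mu> (n - \<mu>)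
        (coeff (dehom (p e))) (coeff (dehom (q e))) $$ (r, n - 1 - i)) * phi3 a b c e)"
      using ij mu_le p q
      by (intro sum.cong refl, subst sylvester_pq_index) (auto simp: sum_distrib_left const2_simps mult.assoc)
    also have "\<dots> = (\<Sum>e<3. const2 (coeff (- cross3 (\<lambda>i. dehom (phi3 a b c i)) (tail_phi j) e) i) * phi3 a b c e)"
      using ij by (subst sum.swap) (intro sum.cong refl,
        simp only: cross_tail_eq_sylvester[of _ i j] lessThan_iff const2_sum sum_distrib_right)
    finally show "transpose_mat (bezout_FG n a b c) $$ (j, i) = (c \<cdot>\<^sub>m (?T * ?S * flip_mat n)) $$ (j, i)"
      using ij T bezout_FG_index[OF abc ij(2,1)] by (simp add: bezout2_def[of n] flip_mat_def)
  qed (use T in \<open>simp_all add: bezout2_def flip_mat_def\<close>)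
qed

section \<open>From the factorization to gcds of minors\<close>

lemma const2_hom: "comm_ring_hom const2"
  by unfold_locales (simp_all add: const2_simps)

lemma Gcd_minors_bezout_FG:
  assumes n: "0 < n"
    and abc: "homog n a" "homog n b" "homog n c"
    and coprime: "\<And>h. h dvd a \<Longrightarrow> h dvd b \<Longrightarrow> h dvd c \<Longrightarrow> is_unit h"
    and mub: "mu_basis a b c n \<mu> p q"
  shows "Gcd (minors (bezout_FG n a b c) k) = normalize (c ^ k * Gcd (minors (sylvester_pq n a b c \<mu> p q) k))"
proof -
  obtain u where pmb:
    "plane_mu_basis (\<lambda>i. dehom (phi3 a b c i)) (\<lambda>i. dehom (p i)) (\<lambda>i. dehom (q i)) u n \<mu>"
    using plane_mu_basis_dehom[OF n abc coprime mub] by blast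
  interpret plane_mu_basis "\<lambda>i. dehom (phi3 a b c i)" "\<lambda>i. dehom (p i)" "\<lambda>i. dehom (q i)" u n \<mu>
    by (rule pmb)
  interpret const2: comm_ring_hom const2
    by (rule const2_hom)
  let ?S = "sylvester_pq n a b c \<mu> p q" and ?T = "map_mat const2 trans_mat"
  have T: "trans_mat \<in> carrier_mat n n"
    by (simp add: trans_mat_def)
  then obtain T' where T': "T' \<in> carrier_mat n n" "T' * trans_mat = 1\<^sub>m n"
    using det_non_zero_imp_unit[OF T det_trans_mat, of "()"] by (auto simp: Units_def ring_mat_def)
  \<comment> \<open>The inverse over the complex numbers remains an inverse after embedding
    constants into the ring of forms.\<close>
  have inv: "map_mat const2 T' * ?T = 1\<^sub>m n"
    using T'(2) by (simp add: const2.mat_hom_one flip: const2.mat_hom_mult[OF T'(1) T])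
  have S: "?S \<in> carrier_mat n n"
    using mu_le by (simp add: sylvester2_def)
  have "Gcd (minors (?T * ?S * flip_mat n) k) = Gcd (minors ?S k)"
    by (rule Gcd_minors_equivalent[where U = ?T and U' = "map_mat const2 T'" and V = "flip_mat n" and V' = "flip_mat n"])
      (use S T T' inv flip_mat_involution in \<open>auto intro!: mult_carrier_mat[of _ n n]\<close>)
  then have "Gcd (minors (transpose_mat (bezout_FG n a b c)) k) = normalize (c ^ k * Gcd (minors ?S k))"
    unfolding bezout_FG_factorization[OF abc mub pmb] minors_smult Gcd_mult by simp
  then show ?thesis
    by (simp only: Gcd_minors_transpose)
qed

theorem theorem6p2:
  fixes a b c :: bpoly and n \<mu> :: nat and p q :: "nat \<Rightarrow> bpoly" and d :: "nat \<Rightarrow> bpoly"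
  assumes n3: "n \<ge> 3"
    and homog_abc: "homog n a" "homog n b" "homog n c"
    and coprime_abc: "\<And>h. h dvd a \<Longrightarrow> h dvd b \<Longrightarrow> h dvd c \<Longrightarrow> is_unit h"
    and biratl: "birational_param a b c"
    and mub: "mu_basis a b c n \<mu> p q"
    and d_homog: "\<And>i. i \<in> {1..n} \<Longrightarrow> \<exists>m. homog m (d i)"
    and d_def: "\<And>i. i \<in> {1..n} \<Longrightarrow>
       assoc (\<Prod>j\<in>{i..n}. d j ^ (j - i + 1))
             (Gcd (minors (sylvester2 \<mu> (n - \<mu>) (phi_coeff a b c p \<mu>) (phi_coeff a b c q (n - \<mu>)))
                          (n + 1 - i)))"
  shows "Gcd (minors (bezout2 n (\<lambda>k. const2 (hcoeff a n k) * c - const2 (hcoeff c n k) * a)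
                                (\<lambda>k. const2 (hcoeff b n k) * c - const2 (hcoeff c n k) * b)) n) = 0
       \<and> (\<forall>i\<in>{1..n-1}.
            assoc (Gcd (minors (bezout2 n (\<lambda>k. const2 (hcoeff a n k) * c - const2 (hcoeff c n k) * a)
                                         (\<lambda>k. const2 (hcoeff b n k) * c - const2 (hcoeff c n k) * b)) (n - i)))
                  (c ^ (n - i) * (\<Prod>j\<in>{i+1..n}. d j ^ (j - i))))"
proof -
  let ?S = "sylvester_pq n a b c \<mu> p q"
  have n: "0 < n"
    using n3 by simp
  have Gcd_bezout: "Gcd (minors (bezout_FG n a b c) k) = normalize (c ^ k * Gcd (minors ?S k))" for k
    by (rule Gcd_minors_bezout_FG[OF n homog_abc coprime_abc mub])
  note mu = mu_basisD(1)[OF mub]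
  have S: "?S \<in> carrier_mat n n"
    using mu by (simp add: sylvester2_def)
  have "det ?S = 0"
    using n mu by (intro det_sylvester_syzygies_eq_0 mu_basisD(2-5)[OF mub]) auto
  then have "Gcd (minors (bezout_FG n a b c) n) = 0"
    by (simp add: Gcd_bezout minors_full[OF S])
  moreover have "assoc (Gcd (minors (bezout_FG n a b c) (n - i))) (c ^ (n - i) * (\<Prod>j\<in>{i+1..n}. d j ^ (j - i)))"
    if i: "i \<in> {1..n-1}" for i
  proof -
    \<comment> \<open>The defining relation is used at \<open>i + 1\<close>, whose minors have size
      \<open>n + 1 - (i + 1) = n - i\<close>.\<close>
    have "(\<Prod>j\<in>{i+1..n}. d j ^ (j - (i + 1) + 1)) = (\<Prod>j\<in>{i+1..n}. d j ^ (j - i))"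
      by (intro prod.cong refl) (simp add: Suc_diff_Suc)
    moreover have "i + 1 \<in> {1..n}"
      using i by auto
    ultimately have "assoc (\<Prod>j\<in>{i+1..n}. d j ^ (j - i)) (Gcd (minors ?S (n - i)))"
      using d_def[of "i + 1"] by simp
    then show ?thesis
      unfolding assoc_def Gcd_bezout by (auto intro: mult_dvd_mono)
  qed
  ultimately show ?thesis
    by blast
qed

end
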